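(* Let $A_1,\ldots,A_m$ be $d\times d$ matrices with entries in $\mathbb{BC}$. Then the joint point spectrum $\sigma_p(A_1,\ldots,A_m)$ is unbounded.
   Context: The bicomplex numbers are the commutative ring $\mathbb{BC}=\{z_1+z_2 j : z_1,z_2\in\mathbb{C}=\mathbb{C}(i)\}$, where $i,j$ are imaginary units with $i^2=j^2=-1$, $ij=ji=k$ and $k^2=1$. The Euclidean norm on $\mathbb{BC}$ is $|z_1+z_2j|=\sqrt{|z_1|^2+|z_2|^2}$. Boundedness of subsets of $\mathbb{BC}^m$ is with respect to the Euclidean norm $\big(\sum_{i=1}^m|\lambda_i|^2\big)^{1/2}$. A tuple $(\lambda_1,\ldots,\lambda_m)\in\mathbb{BC}^m$ is a joint eigenvalue of $(A_1,\ldots,A_m)$ if there is a common nonzero eigenvector $x\in\mathbb{BC}^d$ with $A_ix=\lambda_ix$ for all $i=1,\ldots,m$; the joint point spectrum $\sigma_p(A_1,\ldots,A_m)\subseteq\mathbb{BC}^m$ is the set of all joint eigenvalues of $(A_1,\ldots,A_m)$.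
   Formalization: Added hypothesis: the matrices commute pairwise or their joint point spectrum is nonempty; without it the claim fails, since the 2×2 matrix units E_12 and E_21 have no joint eigenvector, so their joint point spectrum is empty and bounded. *)

theory Defs
  imports "HOL-Analysis.Analysis"
begin

text \<open>\<open>Bicomplex z1 z2\<close> stands for \<open>z1 + z2 j\<close>; the imaginary unit \<open>\<i>\<close> of
  \<^typ>\<open>complex\<close> plays the role of \<open>i\<close>.\<close>

datatype bicomplex = Bicomplex (bc_fst: complex) (bc_snd: complex)

lemma bicomplex_eq_iff: "x = y \<longleftrightarrow> bc_fst x = bc_fst y \<and> bc_snd x = bc_snd y"
  by (cases x; cases y) simp

instantiation bicomplex :: comm_ring_1
begin

definition zero_bicomplex :: bicomplex where "0 = Bicomplex 0 0"

definition one_bicomplex :: bicomplex where "1 = Bicomplex 1 0"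

definition plus_bicomplex :: "bicomplex \<Rightarrow> bicomplex \<Rightarrow> bicomplex" where
  "x + y = Bicomplex (bc_fst x + bc_fst y) (bc_snd x + bc_snd y)"

definition minus_bicomplex :: "bicomplex \<Rightarrow> bicomplex \<Rightarrow> bicomplex" where
  "x - y = Bicomplex (bc_fst x - bc_fst y) (bc_snd x - bc_snd y)"

definition uminus_bicomplex :: "bicomplex \<Rightarrow> bicomplex" where
  "- x = Bicomplex (- bc_fst x) (- bc_snd x)"

definition times_bicomplex :: "bicomplex \<Rightarrow> bicomplex \<Rightarrow> bicomplex" where
  "x * y = Bicomplex (bc_fst x * bc_fst y - bc_snd x * bc_snd y)
                     (bc_fst x * bc_snd y + bc_snd x * bc_fst y)"

instance
  by standard
    (auto simp: bicomplex_eq_iff zero_bicomplex_def one_bicomplex_def plus_bicomplex_def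
      minus_bicomplex_def uminus_bicomplex_def times_bicomplex_def algebra_simps)

end

instantiation bicomplex :: real_vector
begin

definition scaleR_bicomplex :: "real \<Rightarrow> bicomplex \<Rightarrow> bicomplex" where
  "r *\<^sub>R x = Bicomplex (r *\<^sub>R bc_fst x) (r *\<^sub>R bc_snd x)"

instance
  by standard
    (auto simp: bicomplex_eq_iff plus_bicomplex_def scaleR_bicomplex_def algebra_simps)

end

instantiation bicomplex :: real_normed_vector
begin

definition norm_bicomplex :: "bicomplex \<Rightarrow> real" where
  "norm x = sqrt ((cmod (bc_fst x))\<^sup>2 + (cmod (bc_snd x))\<^sup>2)"

definition dist_bicomplex :: "bicomplex \<Rightarrow> bicomplex \<Rightarrow> real" where
  "dist (x :: bicomplex) y = norm (x - y)"

definition sgn_bicomplex :: "bicomplex \<Rightarrow> bicomplex" where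
  "sgn (x :: bicomplex) = x /\<^sub>R norm x"

definition uniformity_bicomplex :: "(bicomplex \<times> bicomplex) filter" where
  "(uniformity :: (bicomplex \<times> bicomplex) filter) = (INF e\<in>{0<..}. principal {(x :: bicomplex, y). dist x y < e})"

definition open_bicomplex :: "bicomplex set \<Rightarrow> bool" where
  "open (U :: bicomplex set) \<longleftrightarrow> (\<forall>x\<in>U. eventually (\<lambda>(x', y). x' = x \<longrightarrow> y \<in> U) uniformity)"

instance
proof
  fix x y :: bicomplex and a b :: real
  have norm_pair: "norm z = norm (bc_fst z, bc_snd z)" for z :: bicomplex
    by (simp add: norm_bicomplex_def norm_Pair)
  show "norm (x + y) \<le> norm x + norm y"
    using norm_triangle_ineq[of "(bc_fst x, bc_snd x)" "(bc_fst y, bc_snd y)"]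
    by (simp add: norm_pair plus_bicomplex_def)
  show "norm x = 0 \<longleftrightarrow> x = 0"
    by (simp add: norm_pair zero_bicomplex_def bicomplex_eq_iff zero_prod_def)
  show "norm (a *\<^sub>R x) = \<bar>a\<bar> * norm x"
    using norm_scaleR[of a "(bc_fst x, bc_snd x)"]
    by (simp add: norm_pair scaleR_bicomplex_def)
qed (auto simp: dist_bicomplex_def sgn_bicomplex_def uniformity_bicomplex_def open_bicomplex_def)

end

definition bc_i :: bicomplex where "bc_i = Bicomplex \<i> 0"

definition bc_j :: bicomplex where "bc_j = Bicomplex 0 1"

definition bc_k :: bicomplex where "bc_k = bc_i * bc_j"

lemma bicomplex_units:
  "bc_i\<^sup>2 = -1" "bc_j\<^sup>2 = -1" "bc_j * bc_i = bc_k" "bc_k\<^sup>2 = 1"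
  by (simp_all add: bc_i_def bc_j_def bc_k_def power2_eq_square times_bicomplex_def
      one_bicomplex_def uminus_bicomplex_def)

lemma Bicomplex_eq: "Bicomplex z1 z2 = Bicomplex z1 0 + Bicomplex z2 0 * bc_j"
  by (simp add: bc_j_def plus_bicomplex_def times_bicomplex_def)

text \<open>The norm of \<open>bicomplex ^ 'm\<close> that determines \<^const>\<open>bounded\<close> is the
  Euclidean one.\<close>

lemma norm_bicomplex_vec: "norm (l :: bicomplex ^ 'm) = sqrt (\<Sum>i\<in>UNIV. (norm (l $ i))\<^sup>2)"
  by (simp add: norm_vec_def L2_set_def)

definition joint_eigenvalue ::
    "('m \<Rightarrow> bicomplex ^ 'd ^ 'd) \<Rightarrow> bicomplex ^ 'm \<Rightarrow> bool" where
  "joint_eigenvalue A l \<longleftrightarrow> (\<exists>x :: bicomplex ^ 'd. x \<noteq> 0 \<and> (\<forall>i. A i *v x = (l $ i) *s x))"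

definition joint_point_spectrum ::
    "('m \<Rightarrow> bicomplex ^ 'd ^ 'd) \<Rightarrow> (bicomplex ^ 'm) set" where
  "joint_point_spectrum A = {l. joint_eigenvalue A l}"

text \<open>Without further hypotheses the joint point spectrum can be empty, hence bounded:
  the two \<open>2 \<times> 2\<close> matrix units below have no common eigenvector.\<close>

definition no_joint_eigenvector :: "2 \<Rightarrow> bicomplex ^ 2 ^ 2" where
  "no_joint_eigenvector i =
     (if i = 1 then vector [vector [0, 1], vector [0, 0]]
      else vector [vector [0, 0], vector [1, 0]])"

lemma joint_point_spectrum_empty: "joint_point_spectrum no_joint_eigenvector = {}"
proof -
  have False
    if x: "x \<noteq> 0" and e: "\<forall>i. no_joint_eigenvector i *v x = (l $ i) *s x"
    for x :: "bicomplex ^ 2" and l :: "bicomplex ^ 2"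
  proof -
    have x2: "x $ 2 = l $ 1 * x $ 1"
      using arg_cong[OF e[rule_format, of 1], of "\<lambda>v. v $ 1"]
      by (simp add: no_joint_eigenvector_def matrix_vector_mult_def sum_2)
    have l2: "l $ 2 * x $ 1 = 0" and x1: "x $ 1 = l $ 2 * x $ 2"
      using arg_cong[OF e[rule_format, of 2], of "\<lambda>v. v $ 1"]
        arg_cong[OF e[rule_format, of 2], of "\<lambda>v. v $ 2"]
      by (simp_all add: no_joint_eigenvector_def matrix_vector_mult_def sum_2)
    have "x $ 1 = l $ 1 * (l $ 2 * x $ 1)"
      using x1 by (subst (asm) x2) (simp add: mult.left_commute)
    with l2 have "x $ 1 = 0" by simp
    with x2 have "x $ 2 = 0" by simp
    with \<open>x $ 1 = 0\<close> x show False
      by (simp add: vec_eq_iff forall_2)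
  qed
  then show ?thesis
    unfolding joint_point_spectrum_def joint_eigenvalue_def by blast
qed

lemma joint_point_spectrum_bounded: "bounded (joint_point_spectrum no_joint_eigenvector)"
  by (simp add: joint_point_spectrum_empty)

end

theory Submission
  imports Defs "HOL-Computational_Algebra.Fundamental_Theorem_Algebra"
begin

text \<open>Write \<open>e = (1 + k)/2\<close> and \<open>f = (1 - k)/2\<close>, so that \<open>e + f = 1\<close> and \<open>e f = 0\<close>. If \<open>x\<close> is a
  joint eigenvector for \<open>l\<close>, then \<open>e x\<close> or \<open>f x\<close> is nonzero, say \<open>e x\<close>; as \<open>f\<close> annihilates it,
  \<open>e x\<close> is a joint eigenvector for \<open>l + t (f, \<dots>, f)\<close> with every real \<open>t\<close>. If the matrices commute,
  a joint eigenvalue exists because \<open>e BC\<close> is a copy of the complex field, over which commuting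
  matrices have a common eigenvector.\<close>

section \<open>Common eigenvectors of commuting matrices\<close>

text \<open>The vector \<open>p(A) v\<close>, evaluated by Horner's rule so that only matrix-vector
  products occur.\<close>

definition poly_mat_vec :: "'a::field ^ 'n ^ 'n \<Rightarrow> 'a poly \<Rightarrow> 'a ^ 'n \<Rightarrow> 'a ^ 'n" where
  "poly_mat_vec A p v = fold_coeffs (\<lambda>a u. a *s v + A *v u) p 0"

lemma poly_mat_vec_0 [simp]: "poly_mat_vec A 0 v = 0"
  by (simp add: poly_mat_vec_def)

lemma poly_mat_vec_pCons [simp]:
  "poly_mat_vec A (pCons a p) v = a *s v + A *v poly_mat_vec A p v"
  by (cases "p = 0 \<and> a = 0") (auto simp: poly_mat_vec_def)

lemma poly_mat_vec_add: "poly_mat_vec A (p + q) v = poly_mat_vec A p v + poly_mat_vec A q v"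
  by (induction p q rule: poly_induct2)
    (simp_all add: vector_sadd_rdistrib matrix_vector_right_distrib)

lemma poly_mat_vec_smult: "poly_mat_vec A (smult c p) v = c *s poly_mat_vec A p v"
  by (induction p) (simp_all add: vector_add_ldistrib vector_smult_assoc vector_scalar_commute)

lemma poly_mat_vec_sum:
  "poly_mat_vec A (\<Sum>i\<in>I. p i) v = (\<Sum>i\<in>I. poly_mat_vec A (p i) v)"
  by (induction I rule: infinite_finite_induct) (simp_all add: poly_mat_vec_add)

lemma poly_mat_vec_monom: "poly_mat_vec A (monom c n) v = c *s (((*v) A) ^^ n) v"
  by (induction n) (simp_all add: monom_0 monom_Suc vector_scalar_commute)

lemma poly_mat_vec_diff_right:
  "poly_mat_vec A p (v - w) = poly_mat_vec A p v - poly_mat_vec A p w"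
  by (induction p) (simp_all add: vector_ssub_ldistrib matrix_vector_mult_diff_distrib)

lemma poly_mat_vec_smult_right: "poly_mat_vec A p (c *s v) = c *s poly_mat_vec A p v"
  by (induction p)
    (simp_all add: vector_add_ldistrib vector_smult_assoc vector_scalar_commute mult.commute)

lemma poly_mat_vec_mult_right: "poly_mat_vec A p (A *v v) = A *v poly_mat_vec A p v"
  by (induction p) (simp_all add: matrix_vector_right_distrib vector_scalar_commute)

text \<open>In dimension \<open>N\<close> the \<open>N + 1\<close> vectors \<open>v\<close>,
  \<open>A v\<close>, ..., \<open>A^N v\<close> are linearly dependent; the coefficients of a
  relation are those of \<open>p\<close>.\<close>

lemma annihilating_poly_exists:
  fixes A :: "'a::field ^ 'n ^ 'n"
  shows "\<exists>p. p \<noteq> 0 \<and> poly_mat_vec A p v = 0"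
proof -
  define u where "u i = (((*v) A) ^^ i) v" for i
  define N where "N = CARD('n)"
  show ?thesis
  \<comment> \<open>Dependence concerns the set of these vectors, which hides repetitions. A
    repetition \<open>u i = u j\<close> gives the polynomial \<open>X^i - X^j\<close>
    directly.\<close>
  proof (cases "inj_on u {..N}")
    case False
    then obtain i j where ij: "u i = u j" "i \<noteq> j"
      by (auto simp: inj_on_def)
    have "coeff (monom 1 i + monom (- 1) j :: 'a poly) i = 1"
      using ij by simp
    then have "monom 1 i + monom (- 1) j \<noteq> (0 :: 'a poly)"
      by (metis coeff_0 zero_neq_one)
    moreover have "poly_mat_vec A (monom 1 i + monom (- 1) j) v = 0"
      using ij by (simp add: poly_mat_vec_add poly_mat_vec_monom u_def)
    ultimately show ?thesis by blast
  next
    case True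
    then have "card (u ` {..N}) = Suc N"
      by (simp add: card_image)
    then have "vec.dependent (u ` {..N})"
      using vec.independent_card_le_dim[OF subset_UNIV, of "u ` {..N}"]
      by (auto simp: N_def vec_dim_card simp del: vec.dim_UNIV)
    then obtain c where c: "\<exists>x\<in>u ` {..N}. c x \<noteq> 0" "(\<Sum>x\<in>u ` {..N}. c x *s x) = 0"
      by (auto simp: vec.dependent_finite)
    define p where "p = (\<Sum>i\<le>N. monom (c (u i)) i)"
    from c obtain i where i: "i \<le> N" "c (u i) \<noteq> 0" by auto
    then have "coeff p i \<noteq> 0"
      by (simp add: p_def coeff_sum if_distrib sum.delta cong: if_cong)
    then have "p \<noteq> 0" by auto
    moreover have "poly_mat_vec A p v = 0"
      using c True by (simp add: p_def poly_mat_vec_sum poly_mat_vec_monom sum.reindex flip: u_def)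
    ultimately show ?thesis by blast
  qed
qed

text \<open>Split off a root: \<open>p = (X - c) q\<close>. Either \<open>(A - c) v = 0\<close>, or
  \<open>(A - c) v\<close> is a nonzero vector of \<open>W\<close> annihilated by \<open>q\<close>,
  which has smaller degree.\<close>

lemma eigenvector_if_annihilating_poly:
  fixes A :: "complex ^ 'n ^ 'n"
  assumes W: "vec.subspace W" "\<And>w. w \<in> W \<Longrightarrow> A *v w \<in> W"
    and "p \<noteq> 0" "v \<in> W" "v \<noteq> 0" "poly_mat_vec A p v = 0"
  shows "\<exists>w\<in>W. \<exists>c. w \<noteq> 0 \<and> A *v w = c *s w"
  using assms(3-)
proof (induction "degree p" arbitrary: p v rule: less_induct)
  case less
  have deg: "degree p > 0"
  proof (rule ccontr)
    assume "\<not> degree p > 0"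
    then obtain a where "p = [:a:]" by (auto elim: degree_eq_zeroE)
    with less.prems show False by simp
  qed
  then have "\<not> constant (poly p)"
    by (simp add: constant_degree)
  then obtain c where c: "poly p c = 0"
    using fundamental_theorem_of_algebra by blast
  define q where "q = synthetic_div p c"
  \<comment> \<open>This is \<open>p = (X - c) q\<close>: the remainder \<open>poly p c\<close>
    vanishes.\<close>
  have pq: "p + smult c q = pCons 0 q"
    using synthetic_div_correct[of p c] c by (simp add: q_def)
  define w where "w = A *v v - c *s v"
  show ?case
  proof (cases "w = 0")
    case True
    then show ?thesis using less.prems by (auto simp: w_def)
  next
    case False
    have "poly_mat_vec A q w = A *v poly_mat_vec A q v - c *s poly_mat_vec A q v"
      by (simp add: w_def poly_mat_vec_diff_right poly_mat_vec_mult_right poly_mat_vec_smult_right)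
    also have "\<dots> = poly_mat_vec A p v"
      using arg_cong[OF pq, of "\<lambda>r. poly_mat_vec A r v"]
      by (simp add: poly_mat_vec_add poly_mat_vec_smult algebra_simps)
    finally have "poly_mat_vec A q w = 0"
      using less.prems by simp
    moreover have "degree q < degree p"
      using deg by (simp add: q_def degree_synthetic_div)
    moreover have "q \<noteq> 0"
      using pq less.prems by auto
    moreover have "w \<in> W"
      using W less.prems by (simp add: w_def vec.subspace_diff vec.subspace_scale)
    ultimately show ?thesis
      using less.hyps False by blast
  qed
qed

text \<open>Induction on \<open>S\<close>: the joint eigenspace \<open>W\<close> for the eigenvalues
  found so far is nonzero and, by commutation, invariant under the next matrix, which therefore has
  an eigenvector in \<open>W\<close>.\<close>

lemma common_eigenvector:
  fixes B :: "'m \<Rightarrow> complex ^ 'n ^ 'n"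
  assumes "finite S" and comm: "\<And>i j. B i ** B j = B j ** B i"
  shows "\<exists>v c. v \<noteq> 0 \<and> (\<forall>i\<in>S. B i *v v = c i *s v)"
  using \<open>finite S\<close>
proof induction
  case empty
  have "(1 :: complex ^ 'n) \<noteq> 0" by simp
  then show ?case by blast
next
  case (insert k S)
  then obtain v c where v: "v \<noteq> 0" "\<forall>i\<in>S. B i *v v = c i *s v" by blast
  define W where "W = {w. \<forall>i\<in>S. B i *v w = c i *s w}"
  have W: "vec.subspace W"
    by (auto simp: W_def vec.subspace_def matrix_vector_right_distrib vector_add_ldistrib
        vector_scalar_commute vector_smult_assoc mult.commute)
  have inv: "B k *v w \<in> W" if "w \<in> W" for w
  proof -
    have "B i *v (B k *v w) = c i *s (B k *v w)" if "i \<in> S" for i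
    proof -
      have "B i *v (B k *v w) = B k *v (B i *v w)"
        by (simp add: matrix_vector_mul_assoc comm[of i k])
      also have "\<dots> = c i *s (B k *v w)"
        using that \<open>w \<in> W\<close> by (simp add: W_def vector_scalar_commute)
      finally show ?thesis .
    qed
    then show ?thesis by (simp add: W_def)
  qed
  obtain p where "p \<noteq> 0" "poly_mat_vec (B k) p v = 0"
    using annihilating_poly_exists by blast
  moreover have "v \<in> W" using v by (simp add: W_def)
  ultimately obtain w d where "w \<in> W" "w \<noteq> 0" "B k *v w = d *s w"
    using eigenvector_if_annihilating_poly[OF W inv] v(1) by blast
  then have "\<forall>i\<in>insert k S. B i *v w = (c(k := d)) i *s w"
    using insert.hyps by (auto simp: W_def)
  with \<open>w \<noteq> 0\<close> show ?case by blast
qed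

section \<open>The idempotent decomposition\<close>

text \<open>\<open>bc_proj\<close> is one of the two ring homomorphisms onto \<open>\<complex>\<close>, and
  \<open>bc_emb c = c (1 + k)/2\<close> embeds \<open>\<complex>\<close> as the ideal on which a bicomplex number acts
  through \<open>bc_proj\<close>.\<close>

definition bc_proj :: "bicomplex \<Rightarrow> complex" where
  "bc_proj a = bc_fst a - \<i> * bc_snd a"

definition bc_emb :: "complex \<Rightarrow> bicomplex" where
  "bc_emb c = Bicomplex (c / 2) (\<i> * c / 2)"

lemmas bicomplex_ops =
  zero_bicomplex_def one_bicomplex_def plus_bicomplex_def times_bicomplex_def

lemma bc_proj_mult: "bc_proj (a * b) = bc_proj a * bc_proj b"
  by (simp add: bc_proj_def bicomplex_ops algebra_simps)

lemma bc_proj_sum: "bc_proj (\<Sum>i\<in>I. f i) = (\<Sum>i\<in>I. bc_proj (f i))"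
proof -
  have "bc_proj 0 = 0" "\<And>a b. bc_proj (a + b) = bc_proj a + bc_proj b"
    by (simp_all add: bc_proj_def bicomplex_ops algebra_simps)
  then show ?thesis
    by (induction I rule: infinite_finite_induct) simp_all
qed

lemma bc_emb_eq_0_iff: "bc_emb c = 0 \<longleftrightarrow> c = 0"
  by (simp add: bc_emb_def bicomplex_ops)

lemma bc_emb_sum: "bc_emb (\<Sum>i\<in>I. f i) = (\<Sum>i\<in>I. bc_emb (f i))"
proof -
  have "bc_emb 0 = 0" "\<And>a b. bc_emb (a + b) = bc_emb a + bc_emb b"
    by (simp_all add: bc_emb_def bicomplex_ops algebra_simps add_divide_distrib)
  then show ?thesis
    by (induction I rule: infinite_finite_induct) simp_all
qed

text \<open>From \<open>k (1 + k) = 1 + k\<close> and \<open>k = i j\<close> it follows that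
  \<open>j\<close> acts on multiples of \<open>1 + k\<close> as \<open>-i\<close>, whence the
  formula for \<open>bc_proj\<close>.\<close>

lemma mult_bc_emb: "a * bc_emb c = bc_emb (bc_proj a * c)"
  by (simp add: bc_emb_def bc_proj_def bicomplex_ops field_simps)

lemma joint_point_spectrum_nonempty:
  fixes A :: "'m::finite \<Rightarrow> bicomplex ^ 'd ^ 'd"
  assumes comm: "\<And>i j. A i ** A j = A j ** A i"
  shows "joint_point_spectrum A \<noteq> {}"
proof -
  define B where "B i = (\<chi> r s. bc_proj (A i $ r $ s))" for i
  have "B i ** B j = (\<chi> r s. bc_proj ((A i ** A j) $ r $ s))" for i j
    by (simp add: B_def matrix_matrix_mult_def bc_proj_sum bc_proj_mult)
  then have "B i ** B j = B j ** B i" for i j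
    by (simp add: comm[of i j])
  then obtain v c where v: "v \<noteq> 0" "\<And>i. B i *v v = c i *s v"
    using common_eigenvector[of UNIV B] by auto
  define x where "x = (\<chi> r. bc_emb (v $ r))"
  \<comment> \<open>Any preimage of \<open>c i\<close> under \<open>bc_proj\<close> acts correctly
    on the image of \<open>bc_emb\<close>; the complex number itself is one.\<close>
  define l :: "bicomplex ^ 'm" where "l = (\<chi> i. Bicomplex (c i) 0)"
  have "x \<noteq> 0"
    using v(1) by (simp add: x_def vec_eq_iff bc_emb_eq_0_iff)
  moreover have "A i *v x = (l $ i) *s x" for i
  proof -
    have "(A i *v x) $ r = bc_emb ((B i *v v) $ r)" for r
      by (simp add: x_def B_def matrix_vector_mult_def mult_bc_emb bc_emb_sum)
    then show ?thesis
      by (simp add: v(2) vec_eq_iff x_def l_def mult_bc_emb bc_proj_def)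
  qed
  ultimately show ?thesis
    unfolding joint_point_spectrum_def joint_eigenvalue_def by blast
qed

lemma matrix_vector_mult_smult:
  fixes M :: "'a::comm_semiring_1 ^ 'n ^ 'k"
  shows "M *v (c *s x) = c *s (M *v x)"
  by (simp add: vec_eq_iff matrix_vector_mult_def sum_distrib_left mult.left_commute)

lemma scaleR_mult_bicomplex: "(t *\<^sub>R a) * b = t *\<^sub>R (a * b :: bicomplex)"
  by (simp add: scaleR_bicomplex_def times_bicomplex_def algebra_simps)

text \<open>The pair \<open>e\<close>, \<open>f\<close> is left general so that the two idempotents
  can exchange roles.\<close>

lemma unbounded_joint_point_spectrum_if_annihilated:
  fixes A :: "'m::finite \<Rightarrow> bicomplex ^ 'd ^ 'd"
  assumes x: "\<And>i. A i *v x = (l $ i) *s x" and "e *s x \<noteq> 0" and "f * e = 0" "f \<noteq> 0"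
  shows "\<not> bounded (joint_point_spectrum A)"
proof
  define u :: "bicomplex ^ 'm" where "u = (\<chi> i. f)"
  have "u \<noteq> 0" using \<open>f \<noteq> 0\<close> by (simp add: u_def vec_eq_iff)
  have mem: "l + t *\<^sub>R u \<in> joint_point_spectrum A" for t
  proof -
    have "A i *v (e *s x) = ((l + t *\<^sub>R u) $ i) *s (e *s x)" for i
      by (simp add: matrix_vector_mult_smult x vec_eq_iff u_def distrib_right
          scaleR_mult_bicomplex \<open>f * e = 0\<close> mult.left_commute)
    then show ?thesis
      using \<open>e *s x \<noteq> 0\<close> unfolding joint_point_spectrum_def joint_eigenvalue_def by blast
  qed
  assume "bounded (joint_point_spectrum A)"
  then obtain b where b: "\<And>y. y \<in> joint_point_spectrum A \<Longrightarrow> norm y \<le> b"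
    by (auto simp: bounded_iff)
  \<comment> \<open>This \<open>t\<close> gives \<open>t *\<^sub>R u\<close> the norm
    \<open>b + norm l + 1\<close>, so the shifted eigenvalue has norm at least
    \<open>b + 1\<close>.\<close>
  define t where "t = (b + norm l + 1) / norm u"
  have "b \<ge> 0"
    using b[OF mem[of 0]] norm_ge_zero order_trans by blast
  then have "norm (t *\<^sub>R u) = b + norm l + 1"
    using \<open>u \<noteq> 0\<close> by (simp add: t_def)
  moreover have "norm (t *\<^sub>R u) \<le> norm (l + t *\<^sub>R u) + norm l"
    using norm_triangle_ineq4[of "l + t *\<^sub>R u" l] by simp
  ultimately show False
    using b[OF mem[of t]] by simp
qed

theorem mainTheorem3:
  fixes A :: "'m::finite \<Rightarrow> bicomplex ^ 'd ^ 'd"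
  assumes "(\<forall>i j. A i ** A j = A j ** A i) \<or> joint_point_spectrum A \<noteq> {}"
  shows "\<not> bounded (joint_point_spectrum A)"
proof -
  have "joint_point_spectrum A \<noteq> {}"
    using assms joint_point_spectrum_nonempty by blast
  then obtain l x where x: "x \<noteq> 0" "\<And>i. A i *v x = (l $ i) *s x"
    unfolding joint_point_spectrum_def joint_eigenvalue_def by blast
  \<comment> \<open>As \<open>k = Bicomplex 0 \<i>\<close>, these are \<open>(1 + k)/2\<close> and
    \<open>(1 - k)/2\<close>.\<close>
  define e where "e = Bicomplex (1 / 2) (\<i> / 2)"
  define f where "f = Bicomplex (1 / 2) (- \<i> / 2)"
  have ef: "e + f = 1" "e * f = 0" "f * e = 0" "e \<noteq> 0" "f \<noteq> 0"
    by (simp_all add: e_def f_def bicomplex_ops)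
  have "e *s x + f *s x = x"
    using ef(1) by (simp add: vec_eq_iff flip: distrib_right)
  then have "e *s x \<noteq> 0 \<or> f *s x \<noteq> 0"
    using x(1) by auto
  then show ?thesis
    using unbounded_joint_point_spectrum_if_annihilated[OF x(2)] ef by blast
qed

end
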